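(* Let $A$ be a $\sigma$-unital $C^*$-algebra which, regarded as a right Hilbert module over itself, has the module Schur property. Then every finitely generated projective Hilbert $A$-module has the module Schur property.
   Context: Hilbert modules are right Hilbert $C^*$-modules, with $A$-valued inner product $\langle\cdot,\cdot\rangle$ that is $A$-linear in the second variable; $A$ itself is a Hilbert $A$-module with $\langle a,b\rangle=a^*b$. A $C^*$-algebra is $\sigma$-unital if it has a countable approximate unit (equivalently, a strictly positive element). A Hilbert $A$-module is finitely generated if there is a finite subset such that every element of the module is an $A$-linear combination of elements of this subset. For a Hilbert $A$-module $V$, the topology $\tau_{\widehat V}$ on $V$ is the locally convex topology generated by the seminorms $x\mapsto\|\langle z,x\rangle\|$, $z\in V$. A sequence $\{x_n\}$ in $V$ is called $\tau_{\widehat V}$-convergent if for every $z\in V$ the sequence $\{\langle z,x_n\rangle\}$ converges in norm in $A$ (so the limit may lie in the completion of $V$ with respect to $\tau_{\widehat V}$, not necessarily in $V$). $V$ has the module Schur property if every $\tau_{\widehat V}$-convergent sequence in $V$ converges in norm (to an element of $V$). *)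

theory Defs
  imports "HOL-Analysis.Analysis"
begin

class complex_normed_vector = real_normed_vector +
  fixes scaleC :: "complex \<Rightarrow> 'a \<Rightarrow> 'a"  (infixr \<open>*\<^sub>C\<close> 75)
  assumes scaleC_add_right: "c *\<^sub>C (x + y) = c *\<^sub>C x + c *\<^sub>C y"
    and scaleC_add_left: "(c + d) *\<^sub>C x = c *\<^sub>C x + d *\<^sub>C x"
    and scaleC_scaleC: "c *\<^sub>C d *\<^sub>C x = (c * d) *\<^sub>C x"
    and scaleC_of_real: "complex_of_real r *\<^sub>C x = r *\<^sub>R x"
    and norm_scaleC: "norm (c *\<^sub>C x) = cmod c * norm x"

text \<open>\<open>C\<^sup>*\<close>-algebras, not assumed unital or nonzero; submultiplicativity of the norm is part of
  \<^class>\<open>real_normed_algebra\<close>, completeness of \<^class>\<open>banach\<close>.\<close>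

class cstar_algebra = complex_normed_vector + real_normed_algebra + banach +
  fixes adj :: "'a \<Rightarrow> 'a"
  assumes mult_scaleC_left: "(c *\<^sub>C a) * b = c *\<^sub>C (a * b)"
    and mult_scaleC_right: "a * (c *\<^sub>C b) = c *\<^sub>C (a * b)"
    and adj_add: "adj (a + b) = adj a + adj b"
    and adj_scaleC: "adj (c *\<^sub>C a) = cnj c *\<^sub>C adj a"
    and adj_mult: "adj (a * b) = adj b * adj a"
    and adj_adj: "adj (adj a) = a"
    and norm_adj_mult_self: "norm (adj a * a) = (norm a)\<^sup>2"

definition cstar_positive :: "'a::cstar_algebra \<Rightarrow> bool" where
  "cstar_positive a \<longleftrightarrow> (\<exists>b. a = adj b * b)"

text \<open>An approximate unit is a net of positive contractions (not required to be increasing). A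
  countable one may be taken to be a sequence, since a countable directed set has a cofinal
  sequence.\<close>

definition countable_approximate_unit :: "(nat \<Rightarrow> 'a::cstar_algebra) \<Rightarrow> bool" where
  "countable_approximate_unit u \<longleftrightarrow>
     (\<forall>n. cstar_positive (u n) \<and> norm (u n) \<le> 1) \<and>
     (\<forall>a. (\<lambda>n. u n * a) \<longlonglongrightarrow> a \<and> (\<lambda>n. a * u n) \<longlonglongrightarrow> a)"

definition sigma_unital :: "'a::cstar_algebra itself \<Rightarrow> bool" where
  "sigma_unital (_ :: 'a itself) \<longleftrightarrow> (\<exists>u :: nat \<Rightarrow> 'a. countable_approximate_unit u)"

text \<open>The whole type \<open>'v\<close> is the module, \<open>act\<close> the right action and \<open>ip\<close> the inner product.
  The norm of the type is required to be the Hilbert module norm, so that \<^class>\<open>banach\<close> expresses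
  completeness of the Hilbert module.\<close>

locale hilbert_module =
  fixes act :: "'v::{complex_normed_vector, banach} \<Rightarrow> 'a::cstar_algebra \<Rightarrow> 'v"
    and ip :: "'v \<Rightarrow> 'v \<Rightarrow> 'a"
  assumes act_add_left: "act (x + y) a = act x a + act y a"
    and act_add_right: "act x (a + b) = act x a + act x b"
    and act_act: "act (act x a) b = act x (a * b)"
    and act_scaleC_left: "act (c *\<^sub>C x) a = c *\<^sub>C act x a"
    and act_scaleC_right: "act x (c *\<^sub>C a) = c *\<^sub>C act x a"
    and ip_add_right: "ip x (y + z) = ip x y + ip x z"
    and ip_scaleC_right: "ip x (c *\<^sub>C y) = c *\<^sub>C ip x y"
    and ip_act_right: "ip x (act y a) = ip x y * a"
    and adj_ip: "adj (ip x y) = ip y x"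
    and ip_self_positive: "cstar_positive (ip x x)"
    and ip_self_eq_0: "ip x x = 0 \<Longrightarrow> x = 0"
    and norm_eq_sqrt_ip: "norm x = sqrt (norm (ip x x))"

definition algebra_ip :: "'a::cstar_algebra \<Rightarrow> 'a \<Rightarrow> 'a" where
  "algebra_ip a b = adj a * b"

lemma hilbert_module_algebra:
  "hilbert_module (times :: 'a::cstar_algebra \<Rightarrow> 'a \<Rightarrow> 'a) algebra_ip"
proof
  fix a :: 'a
  have nrm: "norm (adj a * a) = (norm a)\<^sup>2"
    by (rule norm_adj_mult_self)
  show "cstar_positive (algebra_ip a a)"
    by (auto simp: cstar_positive_def algebra_ip_def)
  show "algebra_ip a a = 0 \<Longrightarrow> a = 0"
    using nrm by (simp add: algebra_ip_def)
  show "norm a = sqrt (norm (algebra_ip a a))"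
    using nrm by (simp add: algebra_ip_def)
qed (simp_all add: algebra_ip_def algebra_simps mult_scaleC_left mult_scaleC_right
       adj_mult adj_adj)

text \<open>Convergence with respect to the topology generated by the seminorms
  \<open>x \<mapsto> \<parallel>\<langle>z, x\<rangle>\<parallel>\<close>; the limit is allowed to lie in the completion for that topology.\<close>

definition tau_convergent :: "('v \<Rightarrow> 'v \<Rightarrow> 'a::cstar_algebra) \<Rightarrow> (nat \<Rightarrow> 'v) \<Rightarrow> bool" where
  "tau_convergent ip X \<longleftrightarrow> (\<forall>z. convergent (\<lambda>n. ip z (X n)))"

definition module_schur_property ::
    "('v::complex_normed_vector \<Rightarrow> 'v \<Rightarrow> 'a::cstar_algebra) \<Rightarrow> bool" where
  "module_schur_property ip \<longleftrightarrow> (\<forall>X. tau_convergent ip X \<longrightarrow> convergent X)"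

definition finitely_generated ::
    "('v::complex_normed_vector \<Rightarrow> 'a::cstar_algebra \<Rightarrow> 'v) \<Rightarrow> bool" where
  "finitely_generated act \<longleftrightarrow>
     (\<exists>S. finite S \<and> (\<forall>x. \<exists>c. x = (\<Sum>s\<in>S. act s (c s))))"

text \<open>The module \<open>A\<^sup>n\<close>: \<open>n\<close>-tuples are sequences vanishing from index \<open>n\<close> on.\<close>

definition free_module :: "nat \<Rightarrow> (nat \<Rightarrow> 'a::cstar_algebra) set" where
  "free_module n = {f. \<forall>i\<ge>n. f i = 0}"

definition free_submodule :: "nat \<Rightarrow> (nat \<Rightarrow> 'a::cstar_algebra) set \<Rightarrow> bool" where
  "free_submodule n P \<longleftrightarrow>
     P \<subseteq> free_module n \<and> (\<lambda>_. 0) \<in> P \<and>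
     (\<forall>f\<in>P. \<forall>g\<in>P. (\<lambda>i. f i + g i) \<in> P) \<and>
     (\<forall>f\<in>P. \<forall>c. (\<lambda>i. c *\<^sub>C f i) \<in> P) \<and>
     (\<forall>f\<in>P. \<forall>a. (\<lambda>i. f i * a) \<in> P)"

definition free_direct_sum ::
    "nat \<Rightarrow> (nat \<Rightarrow> 'a::cstar_algebra) set \<Rightarrow> (nat \<Rightarrow> 'a) set \<Rightarrow> bool" where
  "free_direct_sum n P Q \<longleftrightarrow>
     free_submodule n P \<and> free_submodule n Q \<and> P \<inter> Q = {\<lambda>_. 0} \<and>
     (\<forall>f\<in>free_module n. \<exists>p\<in>P. \<exists>q\<in>Q. f = (\<lambda>i. p i + q i))"

definition module_hom_to_free ::
    "('v::complex_normed_vector \<Rightarrow> 'a::cstar_algebra \<Rightarrow> 'v) \<Rightarrow> ('v \<Rightarrow> nat \<Rightarrow> 'a) \<Rightarrow> bool" where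
  "module_hom_to_free act \<phi> \<longleftrightarrow>
     (\<forall>x y. \<phi> (x + y) = (\<lambda>i. \<phi> x i + \<phi> y i)) \<and>
     (\<forall>c x. \<phi> (c *\<^sub>C x) = (\<lambda>i. c *\<^sub>C \<phi> x i)) \<and>
     (\<forall>x a. \<phi> (act x a) = (\<lambda>i. \<phi> x i * a))"

text \<open>Projectivity is the algebraic notion: the module is isomorphic, by an isomorphism of modules
  that need not be continuous or preserve inner products, to a direct summand of a free module. The
  summand need not be closed or orthogonally complemented. For a finitely generated module the free
  module can be taken to be some \<open>A\<^sup>n\<close>.\<close>

definition finitely_generated_projective ::
    "('v::complex_normed_vector \<Rightarrow> 'a::cstar_algebra \<Rightarrow> 'v) \<Rightarrow> bool" where
  "finitely_generated_projective act \<longleftrightarrow>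
     finitely_generated act \<and>
     (\<exists>n P Q \<phi>. free_direct_sum n P Q \<and> module_hom_to_free act \<phi> \<and> bij_betw \<phi> UNIV P)"

end

theory Submission
  imports Defs
begin

text \<open>Suppose that \<open>V\<close> is generated by a finite set \<open>S\<close>. The conjugate-linear maps
  \<open>z \<mapsto> \<langle>z, x\<rangle>\<close>, with \<open>x\<close> ranging over the set where
  \<open>(\<Sum>s\<in>S. \<parallel>\<langle>s, x\<rangle>\<parallel>) \<le> 1\<close>, are pointwise bounded, because every \<open>z\<close> is an \<open>A\<close>-linear
  combination of elements of \<open>S\<close>. By uniform boundedness they are bounded in norm, and taking \<open>z\<close>
  proportional to \<open>x\<close> gives \<open>\<parallel>x\<parallel> \<le> M * (\<Sum>s\<in>S. \<parallel>\<langle>s, x\<rangle>\<parallel>)\<close> for a constant \<open>M\<close>. The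
  topology \<open>\<tau>\<close> is therefore finer than the norm topology, and \<open>\<tau>\<close>-convergent sequences are Cauchy
  in norm.\<close>

text \<open>Baire category: the closed sets \<open>E n\<close>, on which the whole family is bounded
  by \<open>n\<close>, cover the complete domain, so one of them contains a ball. Linearity carries
  the bound from that ball to all of the space.\<close>

theorem uniform_boundedness_principle:
  fixes f :: "'i \<Rightarrow> 'a::banach \<Rightarrow> 'b::real_normed_vector"
  assumes lin: "\<And>i. i \<in> I \<Longrightarrow> bounded_linear (f i)"
    and pointwise: "\<And>x. \<exists>B. \<forall>i\<in>I. norm (f i x) \<le> B"
  shows "\<exists>B. \<forall>i\<in>I. \<forall>x. norm (f i x) \<le> B * norm x"
proof -
  define E where "E n = {x. \<forall>i\<in>I. norm (f i x) \<le> real n}" for n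
  have closed_E: "closed (E n)" for n
  proof -
    have "E n = (\<Inter>i\<in>I. {x. norm (f i x) \<le> real n})"
      by (auto simp: E_def)
    moreover have "closed {x. norm (f i x) \<le> real n}" if "i \<in> I" for i
      by (intro closed_Collect_le continuous_on_norm continuous_on_const
          linear_continuous_on lin that)
    ultimately show ?thesis
      by auto
  qed
  have "x \<in> (\<Union>n. E n)" for x
  proof -
    obtain B where "\<forall>i\<in>I. norm (f i x) \<le> B"
      using pointwise by blast
    moreover obtain n where "B \<le> real n"
      using real_arch_simple by blast
    ultimately show ?thesis
      unfolding E_def by (auto intro: order_trans)
  qed
  then have cover: "(\<Union>n. E n) = UNIV"
    by blast
  have "\<exists>n. interior (E n) \<noteq> {}"
  proof (rule ccontr)
    assume "\<not> (\<exists>n. interior (E n) \<noteq> {})"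
    then have "euclidean interior_of \<Union>(range E) = ({} :: 'a set)"
      by (intro Baire_category_alt)
        (auto simp: closed_E completely_metrizable_space_euclidean)
    then show False
      using cover by simp
  qed
  then obtain n a where "a \<in> interior (E n)"
    by blast
  then obtain r where r: "r > 0" "cball a r \<subseteq> E n"
    by (meson mem_interior_cball)
  have "norm (f i x) \<le> 2 * real n / r * norm x" if i: "i \<in> I" for i x
  proof (cases "x = 0")
    case True
    then show ?thesis
      using linear_0[OF bounded_linear.linear[OF lin[OF i]]] by simp
  next
    case False
    interpret bounded_linear "f i"
      by (rule lin[OF i])
    \<comment> \<open>With this scale \<open>a + t *\<^sub>R x\<close> lies on the boundary of the
      ball around \<open>a\<close>. Subtracting the value at the centre costs the factor 2.\<close>
    define t where "t = r / norm x"
    have t: "t > 0"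
      using False r by (simp add: t_def)
    have "a + t *\<^sub>R x \<in> E n" "a \<in> E n"
      using r False by (auto intro!: subsetD[OF r(2)] simp: dist_norm t_def)
    then have "norm (f i (a + t *\<^sub>R x)) \<le> real n" "norm (f i a) \<le> real n"
      using i by (auto simp: E_def)
    moreover have "t *\<^sub>R f i x = f i (a + t *\<^sub>R x) - f i a"
      by (simp add: add scaleR)
    ultimately have "norm (t *\<^sub>R f i x) \<le> 2 * real n"
      by (smt (verit) norm_triangle_ineq4)
    then have "t * norm (f i x) \<le> 2 * real n"
      using t by simp
    then show ?thesis
      using r False by (simp add: t_def field_simps)
  qed
  then show ?thesis
    by blast
qed

text \<open>The C*-identity and submultiplicativity bound the norm of \<open>b\<close> by that of
  \<open>adj b\<close>; since \<open>adj\<close> is an involution, equality follows.\<close>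

lemma norm_adj [simp]: "norm (adj a) = norm (a :: 'a::cstar_algebra)"
proof -
  have le: "norm b \<le> norm (adj b)" for b :: 'a
  proof (cases "b = 0")
    case False
    have "norm b * norm b \<le> norm (adj b) * norm b"
      using norm_mult_ineq[of "adj b" b] by (simp add: norm_adj_mult_self power2_eq_square)
    then show ?thesis
      using False by simp
  qed simp
  show ?thesis
    using le[of a] le[of "adj a"] by (simp add: adj_adj)
qed

context hilbert_module
begin

lemma ip_scaleR_right: "ip x (r *\<^sub>R y) = r *\<^sub>R ip x y"
  using ip_scaleC_right[of x "complex_of_real r" y] by (simp add: scaleC_of_real)

lemma ip_add_left: "ip (x + y) z = ip x z + ip y z"
  by (metis adj_add adj_ip ip_add_right)

lemma ip_scaleC_left: "ip (c *\<^sub>C x) y = cnj c *\<^sub>C ip x y"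
  by (metis adj_ip adj_scaleC ip_scaleC_right)

lemma ip_scaleR_left: "ip (r *\<^sub>R x) y = r *\<^sub>R ip x y"
  using ip_scaleC_left[of "complex_of_real r" x y] by (simp add: scaleC_of_real)

lemma ip_act_left: "ip (act x a) y = adj a * ip x y"
  by (metis adj_ip adj_mult ip_act_right)

lemma norm_ip_self: "norm (ip x x) = (norm x)\<^sup>2"
  by (simp add: norm_eq_sqrt_ip)

lemma linear_ip_left: "linear (\<lambda>z. ip z x)"
  by (intro linearI ip_add_left ip_scaleR_left)

lemma linear_ip_right: "linear (ip z)"
  by (intro linearI ip_add_right ip_scaleR_right)

text \<open>Polarization gives the Cauchy--Schwarz inequality up to a constant, without the order
  structure of \<open>A\<close>.\<close>

lemma norm_ip_le: "norm (ip x y) \<le> 6 * norm x * norm y"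
proof (cases "x = 0 \<or> y = 0")
  case True
  then show ?thesis
    using linear_0[OF linear_ip_left] linear_0[OF linear_ip_right] by auto
next
  case False
  \<comment> \<open>The constant is 4 + 2: the square of \<open>norm (u + v)\<close> is at most 4,
    and the two diagonal terms have norm 1 each.\<close>
  have sym: "norm (ip u v + ip v u) \<le> 6" if "norm u = 1" "norm v = 1" for u v
  proof -
    have "norm (u + v) \<le> 2"
      using norm_triangle_ineq[of u v] that by simp
    then have "(norm (u + v))\<^sup>2 \<le> 2\<^sup>2"
      by (intro power_mono) auto
    then have "norm (ip (u + v) (u + v)) \<le> 4"
      by (simp add: norm_ip_self)
    moreover have "ip u v + ip v u = ip (u + v) (u + v) - (ip u u + ip v v)"
      by (simp add: ip_add_left ip_add_right)
    moreover have "norm (ip u u + ip v v) \<le> 2"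
      using norm_triangle_ineq[of "ip u u" "ip v v"] that by (simp add: norm_ip_self)
    ultimately show ?thesis
      using norm_triangle_ineq4[of "ip (u + v) (u + v)" "ip u u + ip v v"] by simp
  qed
  have unit: "norm (ip u v) \<le> 6" if "norm u = 1" "norm v = 1" for u v
  proof -
    \<comment> \<open>Replacing \<open>v\<close> by \<open>w\<close> turns the symmetric sum into
      \<open>\<i> *\<^sub>C (ip u v - ip v u)\<close>, so \<open>sym\<close> also controls the
      antisymmetric part.\<close>
    define w where "w = \<i> *\<^sub>C v"
    have "1 *\<^sub>C a = a" "(- 1) *\<^sub>C a = - a" for a :: 'a
      using scaleC_of_real[of 1 a] scaleC_of_real[of "- 1" a] by simp_all
    then have "2 *\<^sub>R ip u v = (ip u v + ip v u) + (- \<i>) *\<^sub>C (ip u w + ip w u)"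
      by (simp add: w_def ip_scaleC_left ip_scaleC_right scaleC_add_right scaleC_scaleC scaleR_2)
    also have "norm \<dots> \<le> 6 + 6"
    proof (rule order_trans[OF norm_triangle_ineq add_mono])
      show "norm (ip u v + ip v u) \<le> 6"
        using that by (rule sym)
      show "norm ((- \<i>) *\<^sub>C (ip u w + ip w u)) \<le> 6"
        using sym[of u w] that by (simp add: w_def norm_scaleC)
    qed
    finally show ?thesis
      by simp
  qed
  have "norm (ip (x /\<^sub>R norm x) (y /\<^sub>R norm y)) \<le> 6"
    using False by (intro unit) auto
  then show ?thesis
    using False by (simp add: ip_scaleR_left ip_scaleR_right field_simps)
qed

text \<open>Conjugate-linear maps are real-linear, so uniform boundedness over the reals applies to
  them.\<close>

lemma bounded_linear_ip_left: "bounded_linear (\<lambda>z. ip z x)"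
proof (rule bounded_linear_intro)
  show "norm (ip z x) \<le> norm z * (6 * norm x)" for z
    using norm_ip_le[of z x] by (simp add: mult.assoc mult.left_commute)
qed (simp_all add: ip_add_left ip_scaleR_left)

lemma norm_le_sum_norm_ip_generators:
  assumes "finite S" and gen: "\<And>x. \<exists>c. x = (\<Sum>s\<in>S. act s (c s))"
  shows "\<exists>M. \<forall>x. norm x \<le> M * (\<Sum>s\<in>S. norm (ip s x))"
proof -
  define p where "p x = (\<Sum>s\<in>S. norm (ip s x))" for x
  have p_nonneg: "p x \<ge> 0" for x
    by (simp add: p_def sum_nonneg)
  have p_scaleR: "p (r *\<^sub>R x) = \<bar>r\<bar> * p x" for r x
    by (simp add: p_def ip_scaleR_right sum_distrib_left)
  have "\<exists>B. \<forall>x\<in>{x. p x \<le> 1}. norm (ip z x) \<le> B" for z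
  proof -
    obtain c where z: "z = (\<Sum>s\<in>S. act s (c s))"
      using gen by blast
    \<comment> \<open>The coefficients \<open>c\<close> depend on \<open>z\<close> alone, so the
      bound is uniform in \<open>x\<close>.\<close>
    have "norm (ip z x) \<le> (\<Sum>s\<in>S. norm (c s))" if "p x \<le> 1" for x
    proof -
      have "norm (ip z x) = norm (\<Sum>s\<in>S. adj (c s) * ip s x)"
        by (simp add: z linear_sum[OF linear_ip_left] ip_act_left)
      also have "\<dots> \<le> (\<Sum>s\<in>S. norm (c s) * norm (ip s x))"
        by (intro sum_norm_le order_trans[OF norm_mult_ineq]) simp
      also have "\<dots> \<le> (\<Sum>s\<in>S. norm (c s) * 1)"
      proof (intro sum_mono mult_left_mono)
        show "norm (ip s x) \<le> 1" if "s \<in> S" for s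
          using \<open>p x \<le> 1\<close> member_le_sum[of s S "\<lambda>s. norm (ip s x)"] that \<open>finite S\<close>
          by (simp add: p_def)
      qed simp
      finally show ?thesis
        by simp
    qed
    then show ?thesis
      by blast
  qed
  then have "\<exists>B. \<forall>x\<in>{x. p x \<le> 1}. \<forall>z. norm (ip z x) \<le> B * norm z"
    by (intro uniform_boundedness_principle bounded_linear_ip_left)
  then obtain B where B: "\<And>x z. p x \<le> 1 \<Longrightarrow> norm (ip z x) \<le> B * norm z"
    by blast
  have B': "norm x \<le> B" if "p x \<le> 1" "x \<noteq> 0" for x
    using B[OF that(1), of x] that(2) by (simp add: norm_ip_self power2_eq_square)
  have "norm x \<le> B * p x" for x
  proof (cases "x = 0")
    case False
    \<comment> \<open>Otherwise every multiple of \<open>x\<close> would satisfy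
      \<open>p \<le> 1\<close>, including one of norm \<open>\<bar>B\<bar> + 1\<close>, which
      exceeds \<open>B\<close>.\<close>
    have "p x \<noteq> 0"
    proof
      assume "p x = 0"
      then have "norm (((\<bar>B\<bar> + 1) / norm x) *\<^sub>R x) \<le> B"
        using False by (intro B') (auto simp: p_scaleR)
      then show False
        using False by simp
    qed
    then have "p x > 0"
      using p_nonneg[of x] by simp
    then have "norm (x /\<^sub>R p x) \<le> B"
      using False by (intro B') (auto simp: p_scaleR)
    then show ?thesis
      using \<open>p x > 0\<close> by (simp add: field_simps)
  qed (simp add: p_def linear_0[OF linear_ip_right])
  then show ?thesis
    unfolding p_def by blast
qed

theorem finitely_generated_imp_module_schur_property:
  assumes "finitely_generated act"
  shows "module_schur_property ip"
  unfolding module_schur_property_def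
proof (intro allI impI)
  fix X
  assume tau: "tau_convergent ip X"
  obtain S where "finite S" and "\<And>x. \<exists>c. x = (\<Sum>s\<in>S. act s (c s))"
    using assms by (auto simp: finitely_generated_def)
  then obtain M where M: "\<And>x. norm x \<le> M * (\<Sum>s\<in>S. norm (ip s x))"
    using norm_le_sum_norm_ip_generators by blast
  have "Cauchy X"
  proof (rule metric_CauchyI)
    fix e :: real
    assume "e > 0"
    \<comment> \<open>The added ones keep the denominator positive for \<open>M = 0\<close> or empty
      \<open>S\<close>, and make the final estimate strict.\<close>
    define d where "d = e / ((\<bar>M\<bar> + 1) * (real (card S) + 1))"
    have d: "d > 0"
      using \<open>e > 0\<close> by (simp add: d_def add_nonneg_pos)
    have "\<exists>N. \<forall>m\<ge>N. \<forall>n\<ge>N. dist (ip s (X m)) (ip s (X n)) < d" for s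
      using tau d by (auto simp: tau_convergent_def dest!: convergent_Cauchy metric_CauchyD)
    then obtain N where
        N: "\<And>s m n. m \<ge> N s \<Longrightarrow> n \<ge> N s \<Longrightarrow> dist (ip s (X m)) (ip s (X n)) < d"
      by metis
    \<comment> \<open>The sum of the thresholds dominates each \<open>N s\<close>, and it makes
      sense for empty \<open>S\<close> as well.\<close>
    have "dist (X m) (X n) < e" if mn: "m \<ge> (\<Sum>s\<in>S. N s)" "n \<ge> (\<Sum>s\<in>S. N s)" for m n
    proof -
      have le_d: "norm (ip s (X m - X n)) \<le> d" if "s \<in> S" for s
        using N[of s m n] mn member_le_sum[of s S N] that \<open>finite S\<close>
        by (simp add: dist_norm linear_diff[OF linear_ip_right])
      have "dist (X m) (X n) \<le> M * (\<Sum>s\<in>S. norm (ip s (X m - X n)))"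
        unfolding dist_norm by (rule M)
      also have "\<dots> \<le> \<bar>M\<bar> * (real (card S) * d)"
        using sum_bounded_above[OF le_d] by (intro mult_mono) (auto intro: sum_nonneg)
      also have "\<dots> < (\<bar>M\<bar> + 1) * ((real (card S) + 1) * d)"
        by (rule mult_strict_mono) (use d in \<open>auto simp: add_nonneg_pos\<close>)
      also have "\<dots> = e"
        by (simp add: d_def add_nonneg_eq_0_iff)
      finally show ?thesis .
    qed
    then show "\<exists>N. \<forall>m\<ge>N. \<forall>n\<ge>N. dist (X m) (X n) < e"
      by blast
  qed
  then show "convergent X"
    by (rule Cauchy_convergent)
qed

end

theorem corollary4p10:
  fixes act :: "'v::{complex_normed_vector, banach} \<Rightarrow> 'a::cstar_algebra \<Rightarrow> 'v"
    and ip :: "'v \<Rightarrow> 'v \<Rightarrow> 'a"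
  assumes "sigma_unital TYPE('a)"
    and "module_schur_property (algebra_ip :: 'a \<Rightarrow> 'a \<Rightarrow> 'a)"
    and "hilbert_module act ip"
    and "finitely_generated_projective act"
  shows "module_schur_property ip"
  using assms(3,4)
  by (auto simp: finitely_generated_projective_def
      intro: hilbert_module.finitely_generated_imp_module_schur_property)

end
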